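(* Consider the uniform length distribution function $\nu(\ell)=1$ for $\ell\ge1$ (and $\nu(\ell)=0$ for $\ell<1$). Then in the $\nu$-RSA process, for all $\varepsilon>0$, $$L^{(\sqrt{17}-3)/2-\varepsilon}\ll\mathbb{E}[S_L]\le L^{(\sqrt{17}-3)/2},$$ where the upper bound holds for all $L>0$.
   Context: $f\ll g$ means $\lim_{L\to\infty}f(L)/g(L)=0$. $\nu$-RSA process on $[0,L]$ ($L>1$) for a length distribution function $\nu$, with $Z_\nu(L)=\int_0^L\nu(\ell)\,d\ell$: start with $I_0=[0,L]$. At each time $T=1,2,\dots$, independently of the past, sample $b$ uniformly from $[0,L]$ and, independently, a length $\ell\in[1,L]$ with density $\nu(\ell)/Z_\nu(L)$ (here: $\ell$ uniform on $[1,L]$). If $(b,b+\ell)\subseteq I_{T-1}$, the segment is parked and $I_T=I_{T-1}\setminus(b,b+\ell)$; otherwise $I_T=I_{T-1}$. The empty space at saturation is $S_L=\lim_{T\to\infty}\lambda(I_T)$, where $\lambda$ is Lebesgue measure. For $0\le L\le 1$ no segment is parked and $S_L=L$. *)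

theory Defs
  imports "HOL-Probability.Probability"
begin

text \<open>
  A length distribution function is a function \<open>\<nu> :: real \<Rightarrow> real\<close>; the processes below use it
  only for interval lengths \<open>L > 1\<close> with \<open>rsa_Z \<nu> L > 0\<close>.
\<close>

definition rsa_Z :: "(real \<Rightarrow> real) \<Rightarrow> real \<Rightarrow> real" where
  "rsa_Z \<nu> L = (LINT l:{0..L}|lborel. \<nu> l)"

definition rsa_length_measure :: "(real \<Rightarrow> real) \<Rightarrow> real \<Rightarrow> real measure" where
  "rsa_length_measure \<nu> L =
     density lborel (\<lambda>l. ennreal (\<nu> l / rsa_Z \<nu> L) * indicator {1..L} l)"

definition rsa_sample_measure :: "(real \<Rightarrow> real) \<Rightarrow> real \<Rightarrow> (real \<times> real) measure" where
  "rsa_sample_measure \<nu> L = uniform_measure lborel {0..L} \<Otimes>\<^sub>M rsa_length_measure \<nu> L"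

text \<open>
  A point \<open>\<omega>\<close> of the sample space records the pair \<open>(b, \<ell>) = \<omega> T\<close> drawn at each time \<open>T \<ge> 1\<close>;
  the coordinate \<open>\<omega> 0\<close> is never used.
\<close>

definition rsa_space :: "(real \<Rightarrow> real) \<Rightarrow> real \<Rightarrow> (nat \<Rightarrow> real \<times> real) measure" where
  "rsa_space \<nu> L = (\<Pi>\<^sub>M T\<in>UNIV. rsa_sample_measure \<nu> L)"

primrec rsa_free :: "real \<Rightarrow> (nat \<Rightarrow> real \<times> real) \<Rightarrow> nat \<Rightarrow> real set" where
  "rsa_free L \<omega> 0 = {0..L}"
| "rsa_free L \<omega> (Suc T) =
     (let (b, l) = \<omega> (Suc T) in
      if {b<..<b + l} \<subseteq> rsa_free L \<omega> T
      then rsa_free L \<omega> T - {b<..<b + l}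
      else rsa_free L \<omega> T)"

definition rsa_empty_space :: "real \<Rightarrow> (nat \<Rightarrow> real \<times> real) \<Rightarrow> real" where
  "rsa_empty_space L \<omega> = lim (\<lambda>T. measure lborel (rsa_free L \<omega> T))"

text \<open>
  For \<open>L \<le> 1\<close> there is no admissible length and \<open>rsa_space \<nu> L\<close> is not a probability space;
  there \<open>S\<^sub>L\<close> is the constant \<open>L\<close>, and so is its expectation.
\<close>

definition rsa_expected_empty_space :: "(real \<Rightarrow> real) \<Rightarrow> real \<Rightarrow> real" where
  "rsa_expected_empty_space \<nu> L =
     (if L \<le> 1 then L else (LINT \<omega>|rsa_space \<nu> L. rsa_empty_space L \<omega>))"

definition uniform_lengths :: "real \<Rightarrow> real" where
  "uniform_lengths l = (if l \<ge> 1 then 1 else 0)"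

text \<open>
  Since \<open>x / 0 = 0\<close>, the first conjunct is needed: it says that the quotient in the limit is
  genuinely defined for all large \<open>L\<close>.
\<close>

definition much_less :: "(real \<Rightarrow> real) \<Rightarrow> (real \<Rightarrow> real) \<Rightarrow> bool"  (infix "\<lless>" 50) where
  "f \<lless> g \<longleftrightarrow> (\<forall>\<^sub>F L in at_top. g L \<noteq> 0) \<and> ((\<lambda>L. f L / g L) \<longlongrightarrow> 0) at_top"

end

theory Submission imports Defs begin

text \<open>
  Run the process from an arbitrary interval \<open>[p, q]\<close> inside \<open>[0, L]\<close>, always with the samples of
  \<open>[0, L]\<close>. The first sample either changes nothing or splits the interval into \<open>[p, b]\<close> and
  \<open>[b + l, q]\<close>, which from then on evolve separately; expectations do not see that they share the
  later samples. Hence the expected final empty space \<open>s(p, q)\<close> satisfies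
  \<open>\<integral> (s(p, b) + s(b + l, q) - s(p, q)) db dl = 0\<close> over the admissible \<open>(b, l)\<close>, an identity that
  survives \<open>T \<rightarrow> \<infinity>\<close> without any discussion of saturation. If \<open>s\<close> were a function of \<open>x = q - p\<close>, this
  would read \<open>(x - 1)\<^sup>2 s(x) = 4 \<integral>\<^bsub>0\<^esub>\<^bsup>x-1\<^esup> (x - 1 - y) s(y) dy\<close>. Bounds \<open>s \<le> \<psi>\<close> or \<open>s \<ge> \<psi>\<close> for
  shorter gaps thus propagate to longer ones. For \<open>\<psi>(y) = y\<^sup>a\<close> the right-hand side is
  \<open>4 (x - 1)\<^bsup>a+2\<^esup> / ((a + 1) (a + 2))\<close>, and \<open>(a + 1) (a + 2) = 4\<close> exactly for
  \<open>a = (\<surd>17 - 3) / 2\<close>; any smaller exponent leaves a factor above \<open>1\<close>, which absorbs the error terms.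
\<close>

subsection \<open>The process started from an arbitrary free set\<close>

definition park :: "real set \<Rightarrow> real \<times> real \<Rightarrow> real set" where
  "park A z = (if {fst z<..<fst z + snd z} \<subseteq> A then A - {fst z<..<fst z + snd z} else A)"

primrec free_from :: "real set \<Rightarrow> (nat \<Rightarrow> real \<times> real) \<Rightarrow> nat \<Rightarrow> real set" where
  "free_from A \<eta> 0 = A"
| "free_from A \<eta> (Suc T) = park (free_from A \<eta> T) (\<eta> T)"

text \<open>The original process reads its samples from index 1 on; the shift moves the first sample
  to index 0, where \<open>case_nat\<close> will prepend it.\<close>

lemma rsa_free_eq_free_from: "rsa_free L \<omega> T = free_from {0..L} (\<lambda>n. \<omega> (Suc n)) T"
  by (induction T) (auto simp: park_def Let_def split: prod.splits)

text \<open>The definition applies the latest sample last; conditioning needs the earliest one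
  peeled off.\<close>

lemma free_from_Suc: "free_from A \<eta> (Suc T) = free_from (park A (\<eta> 0)) (\<lambda>n. \<eta> (Suc n)) T"
  by (induction T) auto

lemma free_from_subset: "free_from A \<eta> T \<subseteq> A"
  by (induction T) (auto simp: park_def)

lemma sets_free_from: "A \<in> sets borel \<Longrightarrow> free_from A \<eta> T \<in> sets borel"
  by (induction T) (auto simp: park_def)

text \<open>A segment is connected: if it met both sides, it would contain the midpoint of
  \<open>u\<close> and \<open>v\<close>, which neither side contains. So it fits into the union only
  by fitting into one side, and disjointness leaves the other side untouched.\<close>

lemma park_Un:
  assumes "A \<subseteq> {..u}" "B \<subseteq> {v..}" "u < v"
  shows "park (A \<union> B) z = park A z \<union> park B z"
proof -
  define I where "I = {fst z<..<fst z + snd z}"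
  have disj: "A \<inter> B = {}"
    using assms by force
  have sub: "I \<subseteq> A \<or> I \<subseteq> B" if "I \<subseteq> A \<union> B"
  proof (rule ccontr)
    assume "\<not> ?thesis"
    then obtain a b where "a \<in> I" "b \<in> I" "a \<notin> B" "b \<notin> A" by blast
    with that have ab: "a \<in> A" "b \<in> B" "a \<in> I" "b \<in> I" by auto
    then have "a \<le> u" "v \<le> b" using assms by auto
    then have "(u + v) / 2 \<in> I"
      using ab assms(3) by (auto simp: I_def)
    moreover have "(u + v) / 2 \<notin> A \<union> B"
      using assms by (auto simp: subset_iff field_simps) 
    ultimately show False using that by auto
  qed
  have *: "park C z = (if I \<subseteq> C then C - I else C)" for C
    by (simp add: park_def I_def)
  show ?thesis
    unfolding * using sub disj by auto
qed

lemma free_from_Un: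
  assumes "A \<subseteq> {..u}" "B \<subseteq> {v..}" "u < v"
  shows "free_from (A \<union> B) \<eta> T = free_from A \<eta> T \<union> free_from B \<eta> T"
proof (induction T)
  case (Suc T)
  have "free_from A \<eta> T \<subseteq> {..u}" "free_from B \<eta> T \<subseteq> {v..}"
    using free_from_subset assms by blast+
  then show ?case
    using park_Un[OF _ _ assms(3)] Suc by simp
qed simp

lemma fmeasurable_free_from: "free_from {p..q} \<eta> T \<in> fmeasurable lborel"
  by (rule fmeasurableI2[OF _ free_from_subset[of "{p..q}"]]) (auto simp: sets_free_from fmeasurable_def emeasure_lborel_Icc_eq)

text \<open>
  Asking for \<open>0 < snd z\<close> rather than \<open>1 \<le> snd z\<close> makes \<open>gap\<close> below equal to the free space for
  every sample sequence, including the null set of those with lengths below \<open>1\<close>.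
\<close>

definition fits :: "real \<Rightarrow> real \<Rightarrow> real \<times> real \<Rightarrow> bool" where
  "fits p q z \<longleftrightarrow> 0 < snd z \<and> p \<le> fst z \<and> fst z + snd z \<le> q"

primrec gap :: "nat \<Rightarrow> real \<Rightarrow> real \<Rightarrow> (nat \<Rightarrow> real \<times> real) \<Rightarrow> real" where
  "gap 0 p q \<eta> = q - p"
| "gap (Suc T) p q \<eta> =
     (if fits p q (\<eta> 0)
      then gap T p (fst (\<eta> 0)) (\<lambda>n. \<eta> (Suc n))
         + gap T (fst (\<eta> 0) + snd (\<eta> 0)) q (\<lambda>n. \<eta> (Suc n))
      else gap T p q (\<lambda>n. \<eta> (Suc n)))"

text \<open>Induction with the first sample peeled off: a fitting segment of positive length leaves
  two closed intervals at positive distance, which evolve separately by \<open>free_from_Un\<close>,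
  so their measures add.\<close>

lemma measure_free_from:
  assumes "p \<le> q"
  shows "measure lborel (free_from {p..q} \<eta> T) = gap T p q \<eta>"
  using assms
proof (induction T arbitrary: p q \<eta>)
  case (Suc T)
  define b where "b = fst (\<eta> 0)"
  define l where "l = snd (\<eta> 0)"
  define \<theta> where "\<theta> = (\<lambda>n. \<eta> (Suc n))"
  show ?case
  proof (cases "fits p q (\<eta> 0)")
    case True
    then have f: "0 < l" "p \<le> b" "b + l \<le> q" by (auto simp: fits_def b_def l_def)
    have "park {p..q} (\<eta> 0) = {p..b} \<union> {b + l..q}"
      using f by (auto simp: park_def b_def l_def)
    then have "free_from {p..q} \<eta> (Suc T) = free_from {p..b} \<theta> T \<union> free_from {b + l..q} \<theta> T"
      unfolding free_from_Suc using f free_from_Un[of "{p..b}" b "{b + l..q}" "b + l"]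
      by (auto simp: \<theta>_def)
    moreover have "measure lborel (free_from {p..b} \<theta> T \<union> free_from {b + l..q} \<theta> T)
        = measure lborel (free_from {p..b} \<theta> T) + measure lborel (free_from {b + l..q} \<theta> T)"
    proof (rule measure_Un2[THEN trans])
      show "free_from {p..b} \<theta> T \<in> fmeasurable lborel" "free_from {b + l..q} \<theta> T \<in> fmeasurable lborel"
        by (rule fmeasurable_free_from)+
      have "free_from {b + l..q} \<theta> T - free_from {p..b} \<theta> T = free_from {b + l..q} \<theta> T"
        using free_from_subset[of "{p..b}" \<theta> T] free_from_subset[of "{b + l..q}" \<theta> T] f
        by force
      then show "measure lborel (free_from {p..b} \<theta> T)
          + measure lborel (free_from {b + l..q} \<theta> T - free_from {p..b} \<theta> T)
        = measure lborel (free_from {p..b} \<theta> T) + measure lborel (free_from {b + l..q} \<theta> T)"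
        by simp
    qed
    ultimately show ?thesis
      using Suc.IH[of p b \<theta>] Suc.IH[of "b + l" q \<theta>] f True
      by (simp del: free_from.simps add: \<theta>_def b_def l_def)
  next
    case False
    \<comment> \<open>A sample that does not fit either sticks out of the interval or has length at
      most 0; in the latter case the open segment is empty.\<close>
    then have "park {p..q} (\<eta> 0) = {p..q}"
      using Suc.prems by (auto simp: park_def fits_def greaterThanLessThan_subseteq_atLeastAtMost_iff)
    then show ?thesis
      unfolding free_from_Suc using Suc False by simp
  qed
qed simp

lemma gap_nonneg: "p \<le> q \<Longrightarrow> 0 \<le> gap T p q \<eta>"
  by (metis measure_free_from measure_nonneg)

lemma gap_Suc_le:
  assumes "p \<le> q"
  shows "gap (Suc T) p q \<eta> \<le> gap T p q \<eta>"
proof -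
  have "free_from {p..q} \<eta> (Suc T) \<subseteq> free_from {p..q} \<eta> T"
    by (simp add: park_def)
  then show ?thesis
    unfolding measure_free_from[OF assms, symmetric]
    by (rule measure_mono_fmeasurable) (simp_all only: sets_free_from fmeasurable_free_from
        sets_lborel atLeastAtMost_borel)
qed

section \<open>Saturation along a fixed sample sequence\<close>

definition gap_lim :: "real \<Rightarrow> real \<Rightarrow> (nat \<Rightarrow> real \<times> real) \<Rightarrow> real" where
  "gap_lim p q \<eta> = lim (\<lambda>T. gap T p q \<eta>)"

lemma gap_le: "p \<le> q \<Longrightarrow> gap T p q \<eta> \<le> q - p"
  by (induction T) (auto intro: order_trans[OF gap_Suc_le] simp del: gap.simps(2))

lemma gap_tendsto:
  assumes "p \<le> q"
  shows "(\<lambda>T. gap T p q \<eta>) \<longlonglongrightarrow> gap_lim p q \<eta>"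
proof -
  have "decseq (\<lambda>T. gap T p q \<eta>)"
    using assms by (intro decseq_SucI gap_Suc_le)
  then have "convergent (\<lambda>T. gap T p q \<eta>)"
    using gap_nonneg[OF assms] by (metis decseq_convergent convergentI)
  then show ?thesis
    by (simp add: gap_lim_def convergent_LIMSEQ_iff)
qed

lemma gap_lim_bounds:
  assumes "p \<le> q"
  shows "0 \<le> gap_lim p q \<eta>" "gap_lim p q \<eta> \<le> q - p"
  by (rule LIMSEQ_le_const[OF gap_tendsto[OF assms]], use gap_nonneg[OF assms] in blast)
    (rule LIMSEQ_le_const2[OF gap_tendsto[OF assms]], use gap_le[OF assms] in blast)

text \<open>The recursion of \<open>gap\<close> holds exactly for every \<open>T\<close> and every
  sample sequence, so it passes to the limit pathwise.\<close>

lemma gap_lim_case_nat: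
  assumes "p \<le> q"
  shows "gap_lim p q (case_nat z \<eta>) =
    (if fits p q z then gap_lim p (fst z) \<eta> + gap_lim (fst z + snd z) q \<eta> else gap_lim p q \<eta>)"
proof -
  have "(\<lambda>T. gap (Suc T) p q (case_nat z \<eta>)) \<longlonglongrightarrow>
    (if fits p q z then gap_lim p (fst z) \<eta> + gap_lim (fst z + snd z) q \<eta> else gap_lim p q \<eta>)"
    using assms by (auto simp: fits_def intro!: tendsto_add gap_tendsto)
  moreover have "(\<lambda>T. gap (Suc T) p q (case_nat z \<eta>)) \<longlonglongrightarrow> gap_lim p q (case_nat z \<eta>)"
    by (rule LIMSEQ_Suc[OF gap_tendsto[OF assms]])
  ultimately show ?thesis
    by (rule LIMSEQ_unique[THEN sym])
qed

lemma rsa_empty_space_eq: "0 \<le> L \<Longrightarrow> rsa_empty_space L \<omega> = gap_lim 0 L (\<lambda>n. \<omega> (Suc n))"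
  by (simp add: rsa_empty_space_def gap_lim_def rsa_free_eq_free_from measure_free_from)

text \<open>No segment of length at least 1 fits here. The condition on the lengths holds almost
  surely, see \<open>AE_length_ge_1\<close>.\<close>

lemma gap_eq_length:
  assumes "\<And>n. 1 \<le> snd (\<eta> n)" "p \<le> q" "q - p < 1"
  shows "gap T p q \<eta> = q - p"
  using assms
proof (induction T arbitrary: \<eta>)
  case (Suc T)
  have "\<not> fits p q (\<eta> 0)"
    using Suc.prems(1)[of 0] Suc.prems(2,3) by (auto simp: fits_def)
  then show ?case
    using Suc.IH[of "\<lambda>n. \<eta> (Suc n)"] Suc.prems by simp
qed simp

lemma gap_lim_eq_length:
  assumes "\<And>n. 1 \<le> snd (\<eta> n)" "p \<le> q" "q - p < 1"
  shows "gap_lim p q \<eta> = q - p"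
  using gap_eq_length[OF assms] by (simp add: gap_lim_def)

subsection \<open>Conditioning on the first sample\<close>

text \<open>The endpoints vary with the point because the recursive calls start at sampled
  positions; the induction needs this generality.\<close>

lemma borel_measurable_gap:
  assumes "f \<in> borel_measurable N" "g \<in> borel_measurable N"
    and "h \<in> measurable N (PiM UNIV (\<lambda>_::nat. borel \<Otimes>\<^sub>M borel))"
  shows "(\<lambda>x. gap T (f x) (g x) (h x)) \<in> borel_measurable N"
  using assms
proof (induction T arbitrary: f g h)
  case (Suc T)
  note [measurable] = Suc.prems(1,2)
  have h: "(\<lambda>x. h x n) \<in> measurable N (borel \<Otimes>\<^sub>M borel)" for n
    using measurable_compose[OF Suc.prems(3) measurable_component_singleton[of n UNIV]] by simp
  note [measurable] = h[of 0]
  have [measurable]: "(\<lambda>x n. h x (Suc n)) \<in> measurable N (PiM UNIV (\<lambda>_::nat. borel \<Otimes>\<^sub>M borel))"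
    by (rule measurable_PiM_single') (auto simp: space_pair_measure intro: h)
  note [measurable (raw)] = Suc.IH
  show ?case
    unfolding gap.simps fits_def by measurable
qed simp

lemma borel_measurable_gap_lim:
  assumes "f \<in> borel_measurable N" "g \<in> borel_measurable N"
    and "h \<in> measurable N (PiM UNIV (\<lambda>_::nat. borel \<Otimes>\<^sub>M borel))"
  shows "(\<lambda>x. gap_lim (f x) (g x) (h x)) \<in> borel_measurable N"
  unfolding gap_lim_def by (intro borel_measurable_lim_metric borel_measurable_gap assms)

section \<open>The probability space of uniform samples for \<open>[0, L]\<close>\<close>

locale uniform_rsa =
  fixes L :: real
  assumes L_gt_1: "1 < L"
begin

abbreviation \<mu> :: "(real \<times> real) measure" where
  "\<mu> \<equiv> rsa_sample_measure uniform_lengths L"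

abbreviation \<Omega> :: "(nat \<Rightarrow> real \<times> real) measure" where
  "\<Omega> \<equiv> rsa_space uniform_lengths L"

lemma rsa_Z_uniform_lengths: "rsa_Z uniform_lengths L = L - 1"
proof -
  have "rsa_Z uniform_lengths L = (LINT l|lborel. indicator {1..L} l)"
    unfolding rsa_Z_def set_lebesgue_integral_def
    by (intro Bochner_Integration.integral_cong) (auto simp: uniform_lengths_def indicator_def)
  then show ?thesis
    using L_gt_1 by simp
qed

lemma rsa_length_measure_uniform_lengths:
  "rsa_length_measure uniform_lengths L = uniform_measure lborel {1..L}"
  unfolding rsa_length_measure_def uniform_measure_def
proof (rule density_cong)
  show "AE l in lborel. ennreal (uniform_lengths l / rsa_Z uniform_lengths L) * indicator {1..L} l
      = indicator {1..L} l / emeasure lborel {1..L}"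
    using L_gt_1
    by (auto simp: rsa_Z_uniform_lengths uniform_lengths_def indicator_def divide_ennreal
        ennreal_mult[symmetric] simp flip: ennreal_1)
qed (auto simp: uniform_lengths_def[abs_def])

lemma prob_space_uniform_measure_Icc:
  fixes a b :: real assumes "a < b" shows "prob_space (uniform_measure lborel {a..b})"
  using assms by (intro prob_space_uniform_measure) auto

lemma prob_space_sample: "prob_space \<mu>"
  unfolding rsa_sample_measure_def rsa_length_measure_uniform_lengths
  using L_gt_1 by (intro prob_space_pair prob_space_uniform_measure_Icc) auto

lemma sets_sample: "sets \<mu> = sets (borel \<Otimes>\<^sub>M borel)"
  unfolding rsa_sample_measure_def rsa_length_measure_uniform_lengths
  by (intro sets_pair_measure_cong) auto

lemma integral_sample:
  fixes f :: "real \<times> real \<Rightarrow> real"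
  assumes [measurable]: "f \<in> borel_measurable (borel \<Otimes>\<^sub>M borel)"
  shows "(LINT z|\<mu>. f z) = (LINT z|(lborel \<Otimes>\<^sub>M lborel). indicator ({0..L} \<times> {1..L}) z * f z) / (L * (L - 1))"
proof -
  have f: "f \<in> borel_measurable (lborel \<Otimes>\<^sub>M lborel)"
    using assms by (simp cong: measurable_cong_sets sets_pair_measure_cong)
  have "\<mu> = density (lborel \<Otimes>\<^sub>M lborel)
      (\<lambda>(x, y). (indicator {0..L} x / emeasure lborel {0..L}) * (indicator {1..L} y / emeasure lborel {1..L}))"
    unfolding rsa_sample_measure_def rsa_length_measure_uniform_lengths
    unfolding uniform_measure_def
  proof (rule pair_measure_density)
    show "sigma_finite_measure (density lborel (\<lambda>l. indicator {1..L} l / emeasure lborel {1..L}))"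
      using prob_space_uniform_measure_Icc[OF L_gt_1]
      by (simp add: uniform_measure_def prob_space_imp_sigma_finite)
  qed (auto intro: sigma_finite_lborel)
  also have "\<dots> = density (lborel \<Otimes>\<^sub>M lborel)
      (\<lambda>z. ennreal (indicator ({0..L} \<times> {1..L}) z / (L * (L - 1))))"
    using L_gt_1
    by (intro density_cong)
      (auto simp: indicator_def divide_ennreal ennreal_mult[symmetric] simp flip: ennreal_1 split: if_splits)
  finally show ?thesis
    using L_gt_1 f by (simp add: integral_density)
qed

lemma sets_rsa_space: "sets \<Omega> = sets (PiM UNIV (\<lambda>_::nat. borel \<Otimes>\<^sub>M borel))"
  unfolding rsa_space_def by (intro sets_PiM_cong sets_sample refl)

lemma measurable_rsa_space:
  "measurable N \<Omega> = measurable N (PiM UNIV (\<lambda>_::nat. borel \<Otimes>\<^sub>M borel))"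
  by (rule measurable_cong_sets[OF refl sets_rsa_space])

lemma prob_space_rsa_space: "prob_space \<Omega>"
  unfolding rsa_space_def by (rule prob_space_PiM[OF prob_space_sample])

definition expected_gap :: "real \<Rightarrow> real \<Rightarrow> real" where
  "expected_gap p q = (LINT \<eta>|\<Omega>. gap_lim p q \<eta>)"

lemma measurable_gap_lim: "(\<lambda>\<eta>. gap_lim p q \<eta>) \<in> borel_measurable \<Omega>"
  by (intro borel_measurable_gap_lim) (auto simp flip: measurable_rsa_space)

lemma integrable_gap_lim: "p \<le> q \<Longrightarrow> integrable \<Omega> (\<lambda>\<eta>. gap_lim p q \<eta>)"
proof -
  assume pq: "p \<le> q"
  interpret W: prob_space \<Omega> by (rule prob_space_rsa_space)
  show ?thesis
    using gap_lim_bounds[OF pq]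
    by (intro W.integrable_const_bound[where B = "q - p"] measurable_gap_lim) auto
qed

lemma expected_gap_bounds:
  assumes "p \<le> q"
  shows "0 \<le> expected_gap p q" "expected_gap p q \<le> q - p"
proof -
  interpret W: prob_space \<Omega> by (rule prob_space_rsa_space)
  show "0 \<le> expected_gap p q" 
    unfolding expected_gap_def by (intro Bochner_Integration.integral_nonneg gap_lim_bounds assms)
  show "expected_gap p q \<le> q - p"
    unfolding expected_gap_def by (intro W.integral_le_const AE_I2 gap_lim_bounds integrable_gap_lim assms)
qed

text \<open>Joint measurability in both endpoints is what permits integrating over the random
  split.\<close>

lemma borel_measurable_expected_gap [measurable (raw)]:
  assumes [measurable]: "f \<in> borel_measurable N" "g \<in> borel_measurable N"
  shows "(\<lambda>x. expected_gap (f x) (g x)) \<in> borel_measurable N"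
proof -
  interpret W: prob_space \<Omega> by (rule prob_space_rsa_space)
  have "(\<lambda>(x, \<eta>). gap_lim (f x) (g x) \<eta>) \<in> borel_measurable (N \<Otimes>\<^sub>M \<Omega>)"
    unfolding case_prod_beta
    by (intro borel_measurable_gap_lim) (auto intro: measurable_compose[OF measurable_fst] assms simp: measurable_snd simp flip: measurable_rsa_space)
  then show ?thesis
    unfolding expected_gap_def by (rule W.borel_measurable_lebesgue_integral)
qed

text \<open>Prepending an independent sample to an i.i.d. sequence reproduces its law; this turns
  the first sample into an integration variable.\<close>

lemma distr_rsa_space_case_nat: "distr (\<mu> \<Otimes>\<^sub>M \<Omega>) \<Omega> (\<lambda>(z, \<eta>). case_nat z \<eta>) = \<Omega>"
proof -
  interpret sequence_space \<mu>
    by (intro sequence_space.intro product_prob_space.intro product_prob_space_axioms.intro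
        product_sigma_finite.intro prob_space_sample prob_space_imp_sigma_finite)
  show ?thesis
    using PiM_iter by (simp add: rsa_space_def)
qed

lemma measurable_case_nat_rsa_space: "(\<lambda>(z, \<eta>). case_nat z \<eta>) \<in> measurable (\<mu> \<Otimes>\<^sub>M \<Omega>) \<Omega>"
  unfolding rsa_space_def case_prod_beta by (intro measurable_case_nat' measurable_fst measurable_snd)

text \<open>Draw the sequence as a first sample followed by an independent sequence; dropping the
  first coordinate is then the projection \<open>snd\<close>.\<close>

lemma distr_rsa_space_Suc: "distr \<Omega> \<Omega> (\<lambda>\<omega> n. \<omega> (Suc n)) = \<Omega>"
proof -
  interpret W: prob_space \<Omega> by (rule prob_space_rsa_space)
  interpret Q: prob_space \<mu> by (rule prob_space_sample)
  interpret pair_prob_space \<mu> \<Omega> ..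
  have [measurable]: "(\<lambda>\<omega> n. \<omega> (Suc n)) \<in> measurable \<Omega> \<Omega>"
    unfolding rsa_space_def by (rule measurable_PiM_single') (auto simp: space_PiM)
  have "distr \<Omega> \<Omega> (\<lambda>\<omega> n. \<omega> (Suc n))
      = distr (distr (\<mu> \<Otimes>\<^sub>M \<Omega>) \<Omega> (\<lambda>(z, \<eta>). case_nat z \<eta>)) \<Omega> (\<lambda>\<omega> n. \<omega> (Suc n))"
    by (simp only: distr_rsa_space_case_nat)
  also have "\<dots> = distr (\<mu> \<Otimes>\<^sub>M \<Omega>) \<Omega> snd"
    using measurable_case_nat_rsa_space
    by (subst distr_distr) (auto simp: comp_def case_prod_beta')
  also have "\<dots> = \<Omega>"
  proof (rule measure_eqI)
    fix A assume "A \<in> sets (distr (\<mu> \<Otimes>\<^sub>M \<Omega>) \<Omega> snd)"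
    then have A: "A \<in> sets \<Omega>" by simp
    have "snd -` A \<inter> space (\<mu> \<Otimes>\<^sub>M \<Omega>) = space \<mu> \<times> A"
      using sets.sets_into_space[OF A] by (auto simp: space_pair_measure)
    then show "emeasure (distr (\<mu> \<Otimes>\<^sub>M \<Omega>) \<Omega> snd) A = emeasure \<Omega> A"
      using A by (simp add: emeasure_distr W.emeasure_pair_measure_Times Q.emeasure_space_1)
  qed simp
  finally show ?thesis .
qed

lemma rsa_expected_empty_space_eq:
  "rsa_expected_empty_space uniform_lengths L = expected_gap 0 L"
proof -
  have "(\<lambda>\<omega> n. \<omega> (Suc n)) \<in> measurable \<Omega> \<Omega>"
    unfolding rsa_space_def by (rule measurable_PiM_single') (auto simp: space_PiM)
  then have "(LINT \<omega>|\<Omega>. gap_lim 0 L (\<lambda>n. \<omega> (Suc n)))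
      = (LINT \<eta>|distr \<Omega> \<Omega> (\<lambda>\<omega> n. \<omega> (Suc n)). gap_lim 0 L \<eta>)"
    by (simp add: integral_distr measurable_gap_lim)
  moreover have "rsa_empty_space L = (\<lambda>\<omega>. gap_lim 0 L (\<lambda>n. \<omega> (Suc n)))"
    using L_gt_1 by (simp add: fun_eq_iff rsa_empty_space_eq)
  ultimately show ?thesis
    using L_gt_1 unfolding distr_rsa_space_Suc
    by (simp add: rsa_expected_empty_space_def expected_gap_def)
qed

text \<open>Prepending preserves the law, so Fubini integrates out the later samples first; the
  bound \<open>q - p\<close> supplies integrability.\<close>

lemma expected_gap_first_sample:
  assumes "p \<le> q"
  shows "expected_gap p q = (LINT z|\<mu>. (if fits p q z
    then expected_gap p (fst z) + expected_gap (fst z + snd z) q else expected_gap p q))"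
proof -
  interpret W: prob_space \<Omega> by (rule prob_space_rsa_space)
  interpret Q: prob_space \<mu> by (rule prob_space_sample)
  interpret pair_prob_space \<mu> \<Omega> ..
  have meas: "(\<lambda>x. gap_lim p q (case x of (z, \<eta>) \<Rightarrow> case_nat z \<eta>)) \<in> borel_measurable (\<mu> \<Otimes>\<^sub>M \<Omega>)"
    by (rule measurable_compose[OF measurable_case_nat_rsa_space measurable_gap_lim])
  have "expected_gap p q
      = (LINT \<omega>|distr (\<mu> \<Otimes>\<^sub>M \<Omega>) \<Omega> (\<lambda>(z, \<eta>). case_nat z \<eta>). gap_lim p q \<omega>)"
    by (simp only: distr_rsa_space_case_nat expected_gap_def)
  also have "\<dots> = (LINT x|(\<mu> \<Otimes>\<^sub>M \<Omega>). gap_lim p q (case x of (z, \<eta>) \<Rightarrow> case_nat z \<eta>))"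
    by (simp add: integral_distr measurable_case_nat_rsa_space measurable_gap_lim)
  also have "\<dots> = (LINT z|\<mu>. LINT \<eta>|\<Omega>. gap_lim p q (case_nat z \<eta>))"
  proof -
    have "integrable (\<mu> \<Otimes>\<^sub>M \<Omega>) (\<lambda>x. gap_lim p q (case x of (z, \<eta>) \<Rightarrow> case_nat z \<eta>))"
      using gap_lim_bounds[OF assms]
      by (intro integrable_const_bound[where B = "q - p"] meas) auto
    from integral_fst'[OF this] show ?thesis by simp
  qed
  also have "\<dots> = (LINT z|\<mu>. (if fits p q z
    then expected_gap p (fst z) + expected_gap (fst z + snd z) q else expected_gap p q))"
  proof (intro Bochner_Integration.integral_cong refl)
    fix z
    show "(LINT \<eta>|\<Omega>. gap_lim p q (case_nat z \<eta>)) = (if fits p q z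
      then expected_gap p (fst z) + expected_gap (fst z + snd z) q else expected_gap p q)"
      using assms
      by (auto simp: gap_lim_case_nat expected_gap_def fits_def intro!: Bochner_Integration.integral_add integrable_gap_lim)
  qed
  finally show ?thesis .
qed

lemma AE_length_ge_1: "AE \<eta> in \<Omega>. \<forall>n. 1 \<le> snd (\<eta> n)"
  unfolding AE_all_countable
proof
  fix n
  interpret U: prob_space "uniform_measure lborel {0..L}"
    using prob_space_uniform_measure_Icc L_gt_1 by simp
  interpret V: prob_space "uniform_measure lborel {1..L}"
    by (rule prob_space_uniform_measure_Icc[OF L_gt_1])
  interpret UV: pair_prob_space "uniform_measure lborel {0..L}" "uniform_measure lborel {1..L}" ..
  have "AE l in uniform_measure lborel {1..L}. 1 \<le> l"
    using L_gt_1 by (intro AE_uniform_measureI) auto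
  then have "AE z in \<mu>. 1 \<le> snd z"
    unfolding rsa_sample_measure_def rsa_length_measure_uniform_lengths
    by (intro UV.AE_pair_measure borel_measurable_le measurable_const)
      (use measurable_snd[of "uniform_measure lborel {0..L}" "uniform_measure lborel {1..L}"] in auto)
  then show "AE \<eta> in \<Omega>. 1 \<le> snd (\<eta> n)"
    unfolding rsa_space_def by (intro AE_PiM_component prob_space_sample) auto
qed

lemma expected_gap_eq_length:
  assumes "p \<le> q" "q - p < 1"
  shows "expected_gap p q = q - p"
proof -
  interpret W: prob_space \<Omega> by (rule prob_space_rsa_space)
  have "expected_gap p q = (LINT \<eta>|\<Omega>. q - p)"
    unfolding expected_gap_def
    by (rule integral_cong_AE) (use AE_length_ge_1 in \<open>auto simp: measurable_gap_lim assms gap_lim_eq_length\<close>)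
  then show ?thesis by (simp add: W.prob_space)
qed

end

subsection \<open>Integration over the admissible samples\<close>

text \<open>The part of \<open>fits\<close> with lengths in the support of the length law. For
  \<open>0 \<le> p\<close> and \<open>q \<le> L\<close> it lies in the sampling rectangle, so
  \<open>L\<close> no longer enters.\<close>

definition admissible :: "real \<Rightarrow> real \<Rightarrow> (real \<times> real) set" where
  "admissible p q = {z. p \<le> fst z \<and> 1 \<le> snd z \<and> fst z + snd z \<le> q}"

lemma sets_admissible [measurable]: "admissible p q \<in> sets (borel \<Otimes>\<^sub>M borel)"
proof -
  have "{z \<in> space (borel \<Otimes>\<^sub>M borel). p \<le> fst z \<and> 1 \<le> snd z \<and> fst z + snd z \<le> q}
      \<in> sets (borel \<Otimes>\<^sub>M (borel :: real measure))"
    by measurable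
  then show ?thesis by (simp add: admissible_def space_pair_measure)
qed

lemma sets_lborel_pair: "sets (lborel \<Otimes>\<^sub>M lborel) = sets (borel \<Otimes>\<^sub>M borel)"
  by (intro sets_pair_measure_cong) auto

lemma integrable_admissible:
  fixes f :: "real \<times> real \<Rightarrow> real"
  assumes "f \<in> borel_measurable (borel \<Otimes>\<^sub>M borel)" "\<And>z. z \<in> admissible p q \<Longrightarrow> \<bar>f z\<bar> \<le> B"
  shows "integrable (lborel \<Otimes>\<^sub>M lborel) (\<lambda>z. indicator (admissible p q) z * f z)"
proof -
  have sets: "admissible p q \<in> sets (lborel \<Otimes>\<^sub>M lborel)"
    by (simp only: sets_lborel_pair sets_admissible)
  have "emeasure (lborel \<Otimes>\<^sub>M lborel) (admissible p q)
      \<le> emeasure (lborel \<Otimes>\<^sub>M lborel) ({p..q} \<times> {1..q - p})"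
  proof (rule emeasure_mono)
    show "admissible p q \<subseteq> {p..q} \<times> {1..q - p}"
      by (auto simp: admissible_def)
  qed (simp add: sets_lborel_pair pair_measureI)
  also have "\<dots> < \<infinity>"
    by (simp add: lborel.emeasure_pair_measure_Times emeasure_lborel_Icc_eq ennreal_mult_less_top)
  finally have "integrable (lborel \<Otimes>\<^sub>M lborel) (\<lambda>z. indicator (admissible p q) z *\<^sub>R f z)"
    using assms sets
    by (intro integrableI_bounded_set_indicator[where B = B])
      (auto simp: measurable_cong_sets[OF sets_lborel_pair refl])
  then show ?thesis by simp
qed

text \<open>For fixed \<open>b\<close> the admissible lengths form \<open>{1..q - b}\<close>, so
  integrating out \<open>l\<close> leaves the weight \<open>q - 1 - b\<close>; then shift by
  \<open>y = b - p\<close>.\<close>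

lemma integral_admissible_left:
  fixes \<psi> :: "real \<Rightarrow> real"
  assumes [measurable]: "\<psi> \<in> borel_measurable borel"
    and bound: "\<And>y. 0 \<le> y \<Longrightarrow> y \<le> q - p - 1 \<Longrightarrow> \<bar>\<psi> y\<bar> \<le> B"
  shows "(LINT z|(lborel \<Otimes>\<^sub>M lborel). indicator (admissible p q) z * \<psi> (fst z - p))
    = (LINT y:{0..q - p - 1}|lborel. (q - p - 1 - y) * \<psi> y)"
proof -
  have "integrable (lborel \<Otimes>\<^sub>M lborel) (\<lambda>z. indicator (admissible p q) z * \<psi> (fst z - p))"
    by (rule integrable_admissible[where B = B]) (measurable, auto simp: admissible_def intro!: bound)
  from lborel_pair.integral_fst'[OF this]
  have "(LINT z|(lborel \<Otimes>\<^sub>M lborel). indicator (admissible p q) z * \<psi> (fst z - p))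
    = (LINT b|lborel. LINT l|lborel. indicator (admissible p q) (b, l) * \<psi> (b - p))"
    by simp
  also have "\<dots> = (LINT b|lborel. indicator {p..q - 1} b * ((q - 1 - b) * \<psi> (b - p)))"
  proof (intro Bochner_Integration.integral_cong refl)
    fix b
    have "(LINT l|lborel. indicator (admissible p q) (b, l) * \<psi> (b - p))
      = (LINT l|lborel. (indicator {p..} b * \<psi> (b - p)) * indicator {1..q - b} l)"
      by (intro Bochner_Integration.integral_cong) (auto simp: admissible_def indicator_def)
    also have "\<dots> = (indicator {p..} b * \<psi> (b - p)) * measure lborel {1..q - b}"
      by simp
    also have "\<dots> = indicator {p..q - 1} b * ((q - 1 - b) * \<psi> (b - p))"
      \<comment> \<open>If \<open>q - b < 1\<close>, the interval of lengths is empty and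
        \<open>b\<close> lies outside \<open>{p..q - 1}\<close>: both sides vanish.\<close>
      by (cases "1 \<le> q - b") (auto simp: indicator_def)
    finally show "(LINT l|lborel. indicator (admissible p q) (b, l) * \<psi> (b - p))
      = indicator {p..q - 1} b * ((q - 1 - b) * \<psi> (b - p))" .
  qed
  also have "\<dots> = (LINT y|lborel. indicator {p..q - 1} (p + y) * ((q - 1 - (p + y)) * \<psi> y))"
    by (subst lborel_integral_real_affine[of 1 _ p]) auto
  also have "\<dots> = (LINT y:{0..q - p - 1}|lborel. (q - p - 1 - y) * \<psi> y)"
    unfolding set_lebesgue_integral_def
    by (intro Bochner_Integration.integral_cong) (auto simp: indicator_def)
  finally show ?thesis .
qed

text \<open>For a fixed length \<open>l\<close>, the reflection \<open>b \<mapsto> p + q - l - b\<close> exchanges the two new gaps.\<close>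

lemma integral_admissible_right:
  fixes \<psi> :: "real \<Rightarrow> real"
  assumes [measurable]: "\<psi> \<in> borel_measurable borel"
    and bound: "\<And>y. 0 \<le> y \<Longrightarrow> y \<le> q - p - 1 \<Longrightarrow> \<bar>\<psi> y\<bar> \<le> B"
  shows "(LINT z|(lborel \<Otimes>\<^sub>M lborel). indicator (admissible p q) z * \<psi> (q - (fst z + snd z)))
    = (LINT z|(lborel \<Otimes>\<^sub>M lborel). indicator (admissible p q) z * \<psi> (fst z - p))"
proof -
  have l: "integrable (lborel \<Otimes>\<^sub>M lborel) (\<lambda>(b, l). indicator (admissible p q) (b, l) * \<psi> (b - p))"
    unfolding case_prod_beta prod.collapse
    by (rule integrable_admissible[where B = B]) (measurable, auto simp: admissible_def intro!: bound)
  have r: "integrable (lborel \<Otimes>\<^sub>M lborel) (\<lambda>(b, l). indicator (admissible p q) (b, l) * \<psi> (q - (b + l)))"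
    unfolding case_prod_beta prod.collapse
    by (rule integrable_admissible[where B = B]) (measurable, auto simp: admissible_def intro!: bound)
  have "(LINT b|lborel. indicator (admissible p q) (b, l) * \<psi> (q - (b + l)))
      = (LINT b|lborel. indicator (admissible p q) (b, l) * \<psi> (b - p))" for l
    by (subst lborel_integral_real_affine[of "-1" _ "p + q - l"])
      (auto simp: admissible_def indicator_def algebra_simps intro!: Bochner_Integration.integral_cong)
  then show ?thesis
    using lborel_pair.integral_snd[OF l] lborel_pair.integral_snd[OF r]
    by (simp add: case_prod_beta')
qed

lemma LINT_Icc_eq_has_integral:
  fixes f :: "real \<Rightarrow> real"
  assumes "continuous_on {a..b} f" "(f has_integral I) {a..b}"
  shows "(LINT x:{a..b}|lborel. f x) = I"
  using set_borel_integral_eq_integral(2)[OF borel_integrable_atLeastAtMost'[OF assms(1)]]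
    integral_unique[OF assms(2)] by simp

lemma LINT_triangle:
  fixes X :: real assumes "0 \<le> X" shows "(LINT y:{0..X}|lborel. X - y) = X\<^sup>2 / 2"
proof (rule LINT_Icc_eq_has_integral)
  have "((\<lambda>y. X - y) has_integral ((X * X - X\<^sup>2 / 2) - (X * 0 - 0\<^sup>2 / 2))) {0..X}"
    by (rule fundamental_theorem_of_calculus[OF assms])
      (auto intro!: derivative_eq_intros simp flip: has_real_derivative_iff_has_vector_derivative)
  then show "((\<lambda>y. X - y) has_integral X\<^sup>2 / 2) {0..X}"
    by (simp add: power2_eq_square)
qed (auto intro!: continuous_intros)

section \<open>The integral identity and the comparison principle\<close>

context uniform_rsa
begin

text \<open>Subtracting \<open>expected_gap p q\<close> inside the first-sample formula cancels all
  samples that do not fit; the normalisation \<open>L * (L - 1)\<close> drops out because the value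
  is 0.\<close>

lemma integral_admissible_expected_gap:
  assumes "0 \<le> p" "p \<le> q" "q \<le> L"
  shows "(LINT z|(lborel \<Otimes>\<^sub>M lborel). indicator (admissible p q) z *
    (expected_gap p (fst z) + expected_gap (fst z + snd z) q - expected_gap p q)) = 0"
proof -
  interpret Q: prob_space \<mu> by (rule prob_space_sample)
  define g where "g z = (if fits p q z
    then expected_gap p (fst z) + expected_gap (fst z + snd z) q - expected_gap p q else 0)" for z
  have [measurable]: "g \<in> borel_measurable (borel \<Otimes>\<^sub>M borel)"
    unfolding g_def[abs_def] fits_def by measurable
  have bound: "\<bar>g z\<bar> \<le> 3 * (q - p)" for z
    using expected_gap_bounds[of p q] expected_gap_bounds[of p "fst z"]
      expected_gap_bounds[of "fst z + snd z" q] assms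
    by (auto simp: g_def fits_def)
  have int: "integrable \<mu> g"
    by (rule Q.integrable_const_bound[where B = "3 * (q - p)"])
      (use bound in \<open>auto simp: measurable_cong_sets[OF sets_sample refl]\<close>)
  have "expected_gap p q = (LINT z|\<mu>. g z + expected_gap p q)"
    by (subst expected_gap_first_sample[OF assms(2)])
      (auto simp: g_def intro!: Bochner_Integration.integral_cong)
  then have "(LINT z|\<mu>. g z) = 0"
    using int by (simp add: Q.prob_space)
  then have "(LINT z|(lborel \<Otimes>\<^sub>M lborel). indicator ({0..L} \<times> {1..L}) z * g z) = 0"
    using L_gt_1 by (simp add: integral_sample)
  also have "(LINT z|(lborel \<Otimes>\<^sub>M lborel). indicator ({0..L} \<times> {1..L}) z * g z)
      = (LINT z|(lborel \<Otimes>\<^sub>M lborel). indicator (admissible p q) z *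
        (expected_gap p (fst z) + expected_gap (fst z + snd z) q - expected_gap p q))"
    using assms
    by (intro Bochner_Integration.integral_cong)
      (auto simp: g_def fits_def admissible_def indicator_def)
  finally show ?thesis .
qed

text \<open>
  With \<open>k = 1\<close> and \<open>k = -1\<close> this turns upper and lower bounds for shorter gaps into bounds for
  longer ones.
\<close>

lemma expected_gap_comparison:
  fixes \<psi> :: "real \<Rightarrow> real" and k :: real
  assumes [measurable]: "\<psi> \<in> borel_measurable borel"
    and bound: "\<And>y. 0 \<le> y \<Longrightarrow> y \<le> q - p - 1 \<Longrightarrow> \<bar>\<psi> y\<bar> \<le> B"
    and pq: "0 \<le> p" "p + 1 \<le> q" "q \<le> L"
    and le: "\<And>p' q'. p \<le> p' \<Longrightarrow> p' \<le> q' \<Longrightarrow> q' \<le> q \<Longrightarrow> q' - p' \<le> q - p - 1 \<Longrightarrow>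
      k * expected_gap p' q' \<le> \<psi> (q' - p')"
  shows "k * (q - p - 1)\<^sup>2 * expected_gap p q
    \<le> 4 * (LINT y:{0..q - p - 1}|lborel. (q - p - 1 - y) * \<psi> y)"
proof -
  define E where "E = k * expected_gap p q"
  define J where "J = (LINT y:{0..q - p - 1}|lborel. (q - p - 1 - y) * \<psi> y)"
  let ?M = "lborel \<Otimes>\<^sub>M (lborel :: real measure)"
  let ?I = "indicator (admissible p q) :: _ \<Rightarrow> real"
  have intl: "integrable ?M (\<lambda>z. ?I z * \<psi> (fst z - p))"
    by (rule integrable_admissible[where B = B]) (measurable, auto simp: admissible_def intro!: bound)
  have intr: "integrable ?M (\<lambda>z. ?I z * \<psi> (q - (fst z + snd z)))"
    by (rule integrable_admissible[where B = B]) (measurable, auto simp: admissible_def intro!: bound)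
  have int1: "integrable ?M (\<lambda>z. ?I z * E)"
    by (rule integrable_admissible[where B = "\<bar>E\<bar>"]) auto
  have intE: "integrable ?M (\<lambda>z. ?I z *
      (expected_gap p (fst z) + expected_gap (fst z + snd z) q - expected_gap p q))"
  proof (rule integrable_admissible[where B = "3 * (q - p)"])
    fix z assume "z \<in> admissible p q"
    then show "\<bar>expected_gap p (fst z) + expected_gap (fst z + snd z) q - expected_gap p q\<bar> \<le> 3 * (q - p)"
      using expected_gap_bounds[of p q] expected_gap_bounds[of p "fst z"]
        expected_gap_bounds[of "fst z + snd z" q] pq
      by (auto simp: admissible_def)
  qed measurable
  have "0 = (LINT z|?M. k * (?I z *
      (expected_gap p (fst z) + expected_gap (fst z + snd z) q - expected_gap p q)))"
    using integral_admissible_expected_gap[of p q] pq by simp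
  \<comment> \<open>Lengths are at least 1, so both new gaps have length at most
    \<open>q - p - 1\<close> and \<open>le\<close> applies to each.\<close>
  also have "\<dots> \<le> (LINT z|?M. ?I z * \<psi> (fst z - p) + ?I z * \<psi> (q - (fst z + snd z)) - ?I z * E)"
  proof (rule integral_mono)
    fix z
    show "k * (?I z * (expected_gap p (fst z) + expected_gap (fst z + snd z) q - expected_gap p q))
        \<le> ?I z * \<psi> (fst z - p) + ?I z * \<psi> (q - (fst z + snd z)) - ?I z * E"
    proof (cases "z \<in> admissible p q")
      case True
      then show ?thesis
        using le[of p "fst z"] le[of "fst z + snd z" q]
        by (auto simp: admissible_def E_def algebra_simps)
    qed auto
  qed (intro integrable_mult_right intE, intro Bochner_Integration.integrable_diff
        Bochner_Integration.integrable_add intl intr int1)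
  also have "\<dots> = (LINT z|?M. ?I z * \<psi> (fst z - p)) + (LINT z|?M. ?I z * \<psi> (q - (fst z + snd z)))
      - (LINT z|?M. ?I z * E)"
    using intl intr int1 by simp
  \<comment> \<open>Both new gaps contribute \<open>J\<close>, and the constant \<open>E\<close>
    gets the area of the triangle. With \<open>X = q - p - 1\<close> this gives
    \<open>0 \<le> 2 * J - X\<^sup>2 / 2 * E\<close>, whence the factor 4.\<close>
  also have "(LINT z|?M. ?I z * \<psi> (q - (fst z + snd z))) = (LINT z|?M. ?I z * \<psi> (fst z - p))"
    by (rule integral_admissible_right[where B = B]) (use bound in auto)
  also have "(LINT z|?M. ?I z * \<psi> (fst z - p)) = J"
    unfolding J_def by (rule integral_admissible_left[where B = B]) (use bound in auto)
  also have "(LINT z|?M. ?I z * E) = (LINT y:{0..q - p - 1}|lborel. (q - p - 1 - y) * E)"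
    by (rule integral_admissible_left[where B = "\<bar>E\<bar>"]) auto
  also have "\<dots> = (q - p - 1)\<^sup>2 / 2 * E"
    using pq LINT_triangle[of "q - p - 1"] by simp
  finally show ?thesis
    by (simp add: J_def E_def algebra_simps)
qed

end

subsection \<open>Power bounds\<close>

text \<open>A Beta integral, evaluated through \<open>1 / (a + 1) - 1 / (a + 2)\<close>.\<close>

lemma LINT_triangle_powr:
  fixes X a :: real assumes "0 \<le> X" "0 < a"
  shows "(LINT y:{0..X}|lborel. (X - y) * y powr a) = X powr (a + 2) / ((a + 1) * (a + 2))"
proof (rule LINT_Icc_eq_has_integral)
  have X: "X * X powr (a + 1) = X powr (a + 2)"
    using assms by (simp add: powr_mult_base add_ac)
  have "((\<lambda>y. X * y powr a - y powr (a + 1)) has_integral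
      X * (X powr (a + 1) / (a + 1)) - X powr (a + 1 + 1) / (a + 1 + 1)) {0..X}"
    using assms by (intro has_integral_diff has_integral_mult_right has_integral_powr_from_0) auto
  also have "X * (X powr (a + 1) / (a + 1)) - X powr (a + 1 + 1) / (a + 1 + 1)
      = X powr (a + 2) / (a + 1) - X powr (a + 2) / (a + 2)"
    using X by (simp add: add.assoc)
  also have "\<dots> = X powr (a + 2) / ((a + 1) * (a + 2))"
    using assms by (simp add: field_simps)
  finally show "((\<lambda>y. (X - y) * y powr a) has_integral X powr (a + 2) / ((a + 1) * (a + 2))) {0..X}"
  proof (rule has_integral_eq[rotated])
    fix y assume "y \<in> {0..X}"
    then have "y powr (a + 1) = y * y powr a"
      using powr_mult_base[of y a] by (simp add: add.commute)
    then show "X * y powr a - y powr (a + 1) = (X - y) * y powr a"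
      by (simp add: left_diff_distrib)
  qed
qed (use assms in \<open>auto intro!: continuous_intros continuous_on_powr'\<close>)

text \<open>Cutting off \<open>[0, c]\<close> costs at most a term linear in \<open>X\<close>, of
  lower order than the full integral.\<close>

lemma LINT_triangle_powr_tail:
  fixes X a c :: real assumes "0 < c" "c \<le> X" "0 < a"
  shows "X powr (a + 2) / ((a + 1) * (a + 2)) - X * c powr (a + 1) / (a + 1)
    \<le> (LINT y:{c..X}|lborel. (X - y) * y powr a)"
proof -
  define F where "F y = X * (y powr (a + 1) / (a + 1)) - y powr (a + 2) / (a + 2)" for y
  have "(LINT y:{c..X}|lborel. (X - y) * y powr a) = F X - F c"
  proof (rule LINT_Icc_eq_has_integral)
    show "((\<lambda>y. (X - y) * y powr a) has_integral F X - F c) {c..X}"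
    proof (rule fundamental_theorem_of_calculus[OF assms(2)])
      fix y assume "y \<in> {c..X}"
      then have "0 < y" using assms by simp
      have powr: "((\<lambda>y. y powr b) has_real_derivative b * y powr (b - 1)) (at y within {c..X})" for b
        using has_real_derivative_powr[OF \<open>0 < y\<close>] by (rule has_field_derivative_at_within)
      have "(F has_real_derivative
          X * ((a + 1) * y powr (a + 1 - 1) / (a + 1)) - (a + 2) * y powr (a + 2 - 1) / (a + 2))
          (at y within {c..X})"
        unfolding F_def by (intro DERIV_diff DERIV_cmult DERIV_cdivide powr)
      also have "X * ((a + 1) * y powr (a + 1 - 1) / (a + 1)) - (a + 2) * y powr (a + 2 - 1) / (a + 2)
          = X * y powr a - y powr (a + 1)"
        using assms by (simp add: add.commute)
      also have "y powr (a + 1) = y * y powr a"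
        using powr_mult_base[of y a] \<open>0 < y\<close> by (simp add: add.commute)
      finally have "(F has_real_derivative (X - y) * y powr a) (at y within {c..X})"
        by (simp add: left_diff_distrib)
      then show "(F has_vector_derivative (X - y) * y powr a) (at y within {c..X})"
        by (simp add: has_real_derivative_iff_has_vector_derivative)
    qed
  qed (use assms in \<open>auto intro!: continuous_intros\<close>)
  moreover have "F X = X powr (a + 2) / ((a + 1) * (a + 2))"
  proof -
    have "X * X powr (a + 1) = X powr (a + 2)"
      using assms by (simp add: powr_mult_base add_ac)
    then have "F X = X powr (a + 2) / (a + 1) - X powr (a + 2) / (a + 2)"
      by (simp add: F_def)
    then show ?thesis
      using assms by (simp add: field_simps)
  qed
  moreover have "F c \<le> X * c powr (a + 1) / (a + 1)"
    using assms by (simp add: F_def)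
  ultimately show ?thesis by linarith
qed

definition \<alpha> :: real where "\<alpha> = (sqrt 17 - 3) / 2"

lemma \<alpha>_bounds: "1 / 2 < \<alpha>" "\<alpha> < 1"
proof -
  have "4 < sqrt (17::real)" by (rule real_less_rsqrt) simp
  then show "1 / 2 < \<alpha>" by (simp add: \<alpha>_def)
  have "sqrt (17::real) < 5" by (rule real_less_lsqrt) simp_all
  then show "\<alpha> < 1" by (simp add: \<alpha>_def)
qed

lemma \<alpha>_eq: "(\<alpha> + 1) * (\<alpha> + 2) = 4"
proof -
  have "(\<alpha> + 1) * (\<alpha> + 2) = (sqrt 17 * sqrt 17 - 1) / 4"
    by (simp add: \<alpha>_def field_simps)
  then show ?thesis by simp
qed

lemma le_powr_of_le_1:
  fixes x a :: real assumes "0 \<le> x" "x \<le> 1" "a \<le> 1" shows "x \<le> x powr a"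
proof (cases "x = 0")
  case False
  then have "x powr 1 \<le> x powr a"
    using assms by (intro powr_mono') auto
  then show ?thesis using assms by simp
qed simp

section \<open>Inductions over the gap length\<close>

context uniform_rsa
begin

text \<open>A parked segment uses up length at least 1, so an integer bound on the gap length drops
  by one and can carry the induction.\<close>

lemma expected_gap_upper:
  assumes "0 \<le> p" "p \<le> q" "q \<le> L" "q - p \<le> real n"
  shows "expected_gap p q \<le> (q - p) powr \<alpha>"
  using assms
proof (induction n arbitrary: p q)
  case 0
  then show ?case using expected_gap_bounds[of p q] by simp
next
  case (Suc n)
  define X where "X = q - p - 1"
  show ?case
  proof (cases "X \<le> 0")
    case True
    \<comment> \<open>The gap has length at most 1, where the trivial bound by its length is good
      enough.\<close>
    then have "q - p \<le> (q - p) powr \<alpha>"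
      using Suc.prems \<alpha>_bounds by (intro le_powr_of_le_1) (auto simp: X_def)
    then show ?thesis
      using expected_gap_bounds[of p q] Suc.prems by linarith
  next
    case False
    then have X: "0 < X" by simp
    have "1 * (q - p - 1)\<^sup>2 * expected_gap p q
      \<le> 4 * (LINT y:{0..q - p - 1}|lborel. (q - p - 1 - y) * y powr \<alpha>)"
    proof (rule expected_gap_comparison[where B = "X powr \<alpha>"])
      show "\<bar>y powr \<alpha>\<bar> \<le> X powr \<alpha>" if "0 \<le> y" "y \<le> q - p - 1" for y
        using that \<alpha>_bounds by (auto simp: X_def intro!: powr_mono2)
      show "1 * expected_gap p' q' \<le> (q' - p') powr \<alpha>"
        if "p \<le> p'" "p' \<le> q'" "q' \<le> q" "q' - p' \<le> q - p - 1" for p' q'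
        using that Suc.prems Suc.IH[of p' q'] by simp
    qed (use Suc.prems X in \<open>auto simp: X_def\<close>)
    \<comment> \<open>By \<open>\<alpha>_eq\<close> the factor 4 cancels exactly, so the induction
      closes with constant 1.\<close>
    then have "X\<^sup>2 * expected_gap p q \<le> X powr (\<alpha> + 2)"
      using X \<alpha>_bounds unfolding X_def[symmetric] by (simp add: LINT_triangle_powr \<alpha>_eq)
    also have "\<dots> = X\<^sup>2 * X powr \<alpha>"
      using X by (simp add: powr_add)
    finally have "expected_gap p q \<le> X powr \<alpha>"
      using X by simp
    also have "\<dots> \<le> (q - p) powr \<alpha>"
      using X \<alpha>_bounds by (intro powr_mono2) (auto simp: X_def)
    finally show ?thesis .
  qed
qed

text \<open>Base case for the power bound: only very short new gaps are counted, whose expected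
  empty space is known exactly.\<close>

lemma expected_gap_lower_crude:
  assumes "0 \<le> p" "p + 2 \<le> q" "q \<le> L"
  shows "1 / (3 * (q - p - 1)\<^sup>2) \<le> expected_gap p q"
proof -
  define X where "X = q - p - 1"
  have X: "1 \<le> X" using assms by (simp add: X_def)
  \<comment> \<open>The sign matches \<open>k = -1\<close>. The cutoff 1/2 is below 1, so
    \<open>expected_gap_eq_length\<close> applies, and below \<open>X\<close>, so the integral keeps
    all of \<open>[0, 1/2]\<close>.\<close>
  define \<psi> :: "real \<Rightarrow> real" where "\<psi> y = - (indicator {0..1/2} y * y)" for y
  have "-1 * (q - p - 1)\<^sup>2 * expected_gap p q
      \<le> 4 * (LINT y:{0..q - p - 1}|lborel. (q - p - 1 - y) * \<psi> y)"
  proof (rule expected_gap_comparison[where B = "1 / 2"])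
    show "\<psi> \<in> borel_measurable borel" unfolding \<psi>_def[abs_def] by measurable
    show "\<bar>\<psi> y\<bar> \<le> 1 / 2" for y by (auto simp: \<psi>_def indicator_def)
    show "-1 * expected_gap p' q' \<le> \<psi> (q' - p')" if "p' \<le> q'" for p' q'
      using that expected_gap_bounds[of p' q'] expected_gap_eq_length[of p' q']
      by (auto simp: \<psi>_def indicator_def)
  qed (use assms in auto)
  also have "(LINT y:{0..q - p - 1}|lborel. (q - p - 1 - y) * \<psi> y)
      = - (LINT y:{0..1/2}|lborel. (X - y) * y)"
    unfolding set_lebesgue_integral_def X_def[symmetric] using X
    by (subst Bochner_Integration.integral_minus[symmetric])
      (auto intro!: Bochner_Integration.integral_cong simp: \<psi>_def indicator_def)
  also have "(LINT y:{0..1/2}|lborel. (X - y) * y) = X / 8 - 1 / 24"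
  proof (rule LINT_Icc_eq_has_integral)
    have "((\<lambda>y. (X - y) * y) has_integral
        ((X * (1/2)\<^sup>2 / 2 - (1/2)^3 / 3) - (X * 0\<^sup>2 / 2 - 0^3 / 3))) {0..1/2}"
      by (rule fundamental_theorem_of_calculus)
        (auto intro!: derivative_eq_intros simp: power2_eq_square algebra_simps
          simp flip: has_real_derivative_iff_has_vector_derivative)
    then show "((\<lambda>y. (X - y) * y) has_integral X / 8 - 1 / 24) {0..1/2}"
      by (simp add: power2_eq_square power3_eq_cube)
  qed (auto intro!: continuous_intros)
  \<comment> \<open>Indeed \<open>4 * (X / 8 - 1 / 24) = X / 2 - 1 / 6\<close>, which is at least
    1/3 for \<open>1 \<le> X\<close>.\<close>
  finally have "1 / 3 \<le> X\<^sup>2 * expected_gap p q"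
    using X unfolding X_def[symmetric] by simp
  then show ?thesis
    using X unfolding X_def[symmetric] by (simp add: field_simps)
qed

text \<open>Lengths up to \<open>X\<^sub>0 + 1\<close> are settled by \<open>small\<close> and the
  crude bound, longer ones by \<open>large\<close> and induction. The term \<open>C * X\<close> is
  the loss from cutting the integral off at 2, times 4.\<close>

lemma expected_gap_lower:
  fixes \<beta> c X\<^sub>0 :: real
  defines "K \<equiv> 4 / ((\<beta> + 1) * (\<beta> + 2))" and "C \<equiv> 4 * 2 powr (\<beta> + 1) / (\<beta> + 1)"
  assumes \<beta>: "0 < \<beta>" and c: "0 \<le> c" and X\<^sub>0: "2 \<le> X\<^sub>0"
    and small: "\<And>x. 2 \<le> x \<Longrightarrow> x \<le> X\<^sub>0 + 1 \<Longrightarrow> c * x powr \<beta> \<le> 1 / (3 * (x - 1)\<^sup>2)"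
    and large: "\<And>X. X\<^sub>0 \<le> X \<Longrightarrow> X\<^sup>2 * (X + 1) powr \<beta> \<le> K * X powr (\<beta> + 2) - C * X"
  assumes "0 \<le> p" "p + 2 \<le> q" "q \<le> L" "q - p \<le> real n"
  shows "c * (q - p) powr \<beta> \<le> expected_gap p q"
  using assms(8-)
proof (induction n arbitrary: p q)
  case 0
  then show ?case by simp
next
  case (Suc n)
  define X where "X = q - p - 1"
  show ?case
  proof (cases "X \<le> X\<^sub>0")
    case True
    then show ?thesis
      using small[of "q - p"] expected_gap_lower_crude[of p q] Suc.prems by (simp add: X_def)
  next
    case False
    then have X: "2 \<le> X" "X\<^sub>0 \<le> X" using X\<^sub>0 by auto
    \<comment> \<open>The induction hypothesis starts at length 2; shorter gaps are only bounded
      below by 0.\<close>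
    define \<psi> :: "real \<Rightarrow> real" where "\<psi> y = - (c * (indicator {2..} y * y powr \<beta>))" for y
    have "-1 * (q - p - 1)\<^sup>2 * expected_gap p q
        \<le> 4 * (LINT y:{0..q - p - 1}|lborel. (q - p - 1 - y) * \<psi> y)"
    proof (rule expected_gap_comparison[where B = "c * X powr \<beta>"])
      show "\<psi> \<in> borel_measurable borel" unfolding \<psi>_def[abs_def] by measurable
      show "\<bar>\<psi> y\<bar> \<le> c * X powr \<beta>" if "0 \<le> y" "y \<le> q - p - 1" for y
        using that \<beta> c by (auto simp: X_def \<psi>_def indicator_def abs_mult intro!: powr_mono2 mult_left_mono)
      show "-1 * expected_gap p' q' \<le> \<psi> (q' - p')"
        if "p \<le> p'" "p' \<le> q'" "q' \<le> q" "q' - p' \<le> q - p - 1" for p' q'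
        using that Suc.prems Suc.IH[of p' q'] expected_gap_bounds[of p' q']
        by (auto simp: \<psi>_def indicator_def)
    qed (use Suc.prems in auto)
    also have "(LINT y:{0..q - p - 1}|lborel. (q - p - 1 - y) * \<psi> y)
        = (LINT y|lborel. - (c * (indicator {2..X} y *\<^sub>R ((X - y) * y powr \<beta>))))"
      unfolding set_lebesgue_integral_def X_def[symmetric]
      by (intro Bochner_Integration.integral_cong) (auto simp: \<psi>_def indicator_def)
    also have "\<dots> = - (c * (LINT y:{2..X}|lborel. (X - y) * y powr \<beta>))"
      unfolding set_lebesgue_integral_def by simp
    finally have "4 * (c * (LINT y:{2..X}|lborel. (X - y) * y powr \<beta>)) \<le> X\<^sup>2 * expected_gap p q"
      by (simp add: X_def)
    moreover have "4 * (c * (X powr (\<beta> + 2) / ((\<beta> + 1) * (\<beta> + 2)) - X * 2 powr (\<beta> + 1) / (\<beta> + 1)))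
        \<le> 4 * (c * (LINT y:{2..X}|lborel. (X - y) * y powr \<beta>))"
      using X \<beta> c by (intro mult_left_mono LINT_triangle_powr_tail) auto
    moreover have "4 * (c * (X powr (\<beta> + 2) / ((\<beta> + 1) * (\<beta> + 2)) - X * 2 powr (\<beta> + 1) / (\<beta> + 1)))
        = c * (K * X powr (\<beta> + 2) - C * X)"
      by (simp add: K_def C_def algebra_simps)
    moreover have "c * (X\<^sup>2 * (X + 1) powr \<beta>) \<le> c * (K * X powr (\<beta> + 2) - C * X)"
      using large[OF X(2)] c by (rule mult_left_mono)
    ultimately have "X\<^sup>2 * (c * (X + 1) powr \<beta>) \<le> X\<^sup>2 * expected_gap p q"
      unfolding mult.left_commute[of _ c] by linarith
    then have "c * (X + 1) powr \<beta> \<le> expected_gap p q"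
      using X by simp
    then show ?thesis by (simp add: X_def)
  qed
qed

end

section \<open>Bounds for the original process and the limit\<close>

lemma rsa_expected_empty_space_lower:
  assumes \<beta>: "0 < \<beta>" "\<beta> < \<alpha>"
  obtains c where "0 < c"
    "\<And>L. 2 \<le> L \<Longrightarrow> c * L powr \<beta> \<le> rsa_expected_empty_space uniform_lengths L"
proof -
  \<comment> \<open>All constants depend on \<open>\<beta>\<close> alone, so one \<open>c\<close>
    serves every \<open>L\<close>.\<close>
  define K where "K = 4 / ((\<beta> + 1) * (\<beta> + 2))"
  define C where "C = 4 * 2 powr (\<beta> + 1) / (\<beta> + 1)"
  \<comment> \<open>Beyond this point \<open>(K - 1) * X \<ge> C + 1\<close>, which pays for both
    errors in \<open>large\<close>: the cutoff loss and the passage from \<open>X\<close> to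
    \<open>X + 1\<close>.\<close>
  define X\<^sub>0 where "X\<^sub>0 = max 2 ((C + 1) / (K - 1))"
  \<comment> \<open>Chosen for \<open>small\<close>: there \<open>x - 1 \<le> X\<^sub>0\<close> and
    \<open>x powr \<beta> \<le> (X\<^sub>0 + 1) powr \<beta>\<close>.\<close>
  define c where "c = 1 / (3 * X\<^sub>0\<^sup>2 * (X\<^sub>0 + 1) powr \<beta>)"
  have "(\<beta> + 1) * (\<beta> + 2) < (\<alpha> + 1) * (\<alpha> + 2)"
    using \<beta> by (intro mult_strict_mono) auto
  then have K: "1 < K"
    using \<beta> by (simp add: K_def \<alpha>_eq)
  have C: "0 \<le> C" using \<beta> by (simp add: C_def)
  have X\<^sub>0: "2 \<le> X\<^sub>0" by (simp add: X\<^sub>0_def)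
  have c: "0 < c" using X\<^sub>0 by (simp add: c_def)
  have small: "c * x powr \<beta> \<le> 1 / (3 * (x - 1)\<^sup>2)" if "2 \<le> x" "x \<le> X\<^sub>0 + 1" for x
  proof -
    have "c * x powr \<beta> \<le> c * (X\<^sub>0 + 1) powr \<beta>"
      using that c \<beta> by (intro mult_left_mono powr_mono2) auto
    also have "\<dots> = 1 / (3 * X\<^sub>0\<^sup>2)"
      using X\<^sub>0 by (simp add: c_def)
    also have "\<dots> \<le> 1 / (3 * (x - 1)\<^sup>2)"
      using that by (intro divide_left_mono mult_left_mono power_mono) auto
    finally show ?thesis .
  qed
  have large: "X\<^sup>2 * (X + 1) powr \<beta> \<le> K * X powr (\<beta> + 2) - C * X" if "X\<^sub>0 \<le> X" for X
  proof -
    have X: "2 \<le> X" using that X\<^sub>0 by simp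
    define Y where "Y = X powr (\<beta> + 1)"
    have XY: "X powr (\<beta> + 2) = X * Y"
      using X by (simp add: Y_def powr_mult_base add_ac)
    have "(X + 1) powr \<beta> = X powr \<beta> * (1 + 1 / X) powr \<beta>"
      using X by (subst powr_mult[symmetric]) (auto simp: distrib_left)
    \<comment> \<open>As \<open>\<beta> < 1\<close>, passing from \<open>X\<close> to
      \<open>X + 1\<close> costs only one extra \<open>Y\<close>.\<close>
    also have "\<dots> \<le> X powr \<beta> * (1 + 1 / X) powr 1"
      using X \<beta> \<alpha>_bounds by (intro mult_left_mono powr_mono) auto
    finally have "X\<^sup>2 * (X + 1) powr \<beta> \<le> X\<^sup>2 * (X powr \<beta> * (1 + 1 / X))"
      using X by (intro mult_left_mono) auto
    also have "\<dots> = X * Y + Y"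
      using X by (simp add: Y_def powr_add field_simps power2_eq_square)
    finally have 1: "X\<^sup>2 * (X + 1) powr \<beta> \<le> X * Y + Y" .
    have "X powr 1 \<le> Y"
      unfolding Y_def using X \<beta> by (intro powr_mono) auto
    then have 2: "C * X \<le> C * Y" and "0 \<le> Y"
      using X C by (auto intro: mult_left_mono)
    have "(C + 1) / (K - 1) \<le> X" using that by (simp add: X\<^sub>0_def)
    then have "C + 1 \<le> X * (K - 1)" using K by (simp add: field_simps)
    then have "(C + 1) * Y \<le> X * (K - 1) * Y"
      using \<open>0 \<le> Y\<close> by (rule mult_right_mono)
    then show ?thesis
      using 1 2 unfolding XY by (simp add: algebra_simps)
  qed
  show thesis
  proof (rule that[OF c])
    fix L :: real assume L: "2 \<le> L"
    then interpret uniform_rsa L by unfold_locales simp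
    obtain n where "L \<le> real n" using real_arch_simple by blast
    then show "c * L powr \<beta> \<le> rsa_expected_empty_space uniform_lengths L"
      using expected_gap_lower[of \<beta> c X\<^sub>0 0 L n] small large \<beta> c X\<^sub>0 L
      unfolding rsa_expected_empty_space_eq K_def C_def by simp
  qed
qed

lemma rsa_expected_empty_space_upper:
  assumes "0 < L"
  shows "rsa_expected_empty_space uniform_lengths L \<le> L powr \<alpha>"
proof (cases "L \<le> 1")
  case True
  then show ?thesis
    using assms \<alpha>_bounds le_powr_of_le_1[of L \<alpha>] by (simp add: rsa_expected_empty_space_def)
next
  case False
  then interpret uniform_rsa L by unfold_locales simp
  obtain n where "L \<le> real n" using real_arch_simple by blast
  then show ?thesis
    using expected_gap_upper[of 0 L n] assms by (simp add: rsa_expected_empty_space_eq)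
qed

lemma powr_much_less_rsa_expected_empty_space:
  assumes "0 < \<epsilon>"
  shows "(\<lambda>L. L powr (\<alpha> - \<epsilon>)) \<lless> rsa_expected_empty_space uniform_lengths"
proof -
  \<comment> \<open>An exponent strictly between \<open>\<alpha> - \<epsilon>\<close> and
    \<open>\<alpha>\<close>; the value 1/4, below \<open>\<alpha>\<close>, keeps it positive when
    \<open>\<epsilon>\<close> is large. The quotient then decays like
    \<open>L powr (\<alpha> - \<epsilon> - \<beta>)\<close> at least.\<close>
  define \<beta> where "\<beta> = max (1 / 4) (\<alpha> - \<epsilon> / 2)"
  have \<beta>: "0 < \<beta>" "\<beta> < \<alpha>" "\<alpha> - \<epsilon> < \<beta>"
    using assms \<alpha>_bounds by (auto simp: \<beta>_def)
  obtain c where c: "0 < c"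
    "\<And>L. 2 \<le> L \<Longrightarrow> c * L powr \<beta> \<le> rsa_expected_empty_space uniform_lengths L"
    using rsa_expected_empty_space_lower[OF \<beta>(1,2)] by blast
  have pos: "0 < rsa_expected_empty_space uniform_lengths L" if "2 \<le> L" for L
  proof -
    have "0 < c * L powr \<beta>" using c(1) that by simp
    then show ?thesis using c(2)[OF that] by linarith
  qed
  have "((\<lambda>L. L powr (\<alpha> - \<epsilon>) / rsa_expected_empty_space uniform_lengths L) \<longlongrightarrow> 0) at_top"
  proof (rule tendsto_sandwich)
    show "\<forall>\<^sub>F L in at_top. 0 \<le> L powr (\<alpha> - \<epsilon>) / rsa_expected_empty_space uniform_lengths L"
      using eventually_ge_at_top[of 2] by eventually_elim (simp add: pos less_imp_le)
    show "\<forall>\<^sub>F L in at_top. L powr (\<alpha> - \<epsilon>) / rsa_expected_empty_space uniform_lengths L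
        \<le> L powr (\<alpha> - \<epsilon> - \<beta>) / c"
      using eventually_ge_at_top[of 2]
    proof eventually_elim
      case (elim L)
      then have "L powr (\<alpha> - \<epsilon>) / rsa_expected_empty_space uniform_lengths L
          \<le> L powr (\<alpha> - \<epsilon>) / (c * L powr \<beta>)"
        using c(1) c(2)[OF elim] pos[OF elim] by (intro divide_left_mono) auto
      then show ?case
        by (simp add: powr_diff mult_ac)
    qed
    have "((\<lambda>L. L powr (\<alpha> - \<epsilon> - \<beta>)) \<longlongrightarrow> 0) at_top"
      using \<beta> by (intro tendsto_neg_powr filterlim_ident) auto
    then show "((\<lambda>L. L powr (\<alpha> - \<epsilon> - \<beta>) / c) \<longlongrightarrow> 0) at_top"
      by (rule tendsto_divide_zero)
  qed simp
  moreover have "\<forall>\<^sub>F L in at_top. rsa_expected_empty_space uniform_lengths L \<noteq> 0"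
    using eventually_ge_at_top[of 2] by eventually_elim (use pos in force)
  ultimately show ?thesis by (simp add: much_less_def)
qed

theorem mainTheorem6:
  shows "(\<forall>\<epsilon>::real. \<epsilon> > 0 \<longrightarrow> (\<lambda>L::real. L powr ((sqrt 17 - 3) / 2 - \<epsilon>))
                   \<lless> rsa_expected_empty_space uniform_lengths)
       \<and> (\<forall>L::real. L > 0 \<longrightarrow> rsa_expected_empty_space uniform_lengths L \<le> L powr ((sqrt 17 - 3) / 2))"
  using powr_much_less_rsa_expected_empty_space rsa_expected_empty_space_upper
  unfolding \<alpha>_def by blast

end
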